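(* Let $X$ be a compact Hausdorff space. Then there are group isomorphisms $$\pi_{\mathbb{R}}^{alg}\big(C(X)\big)\cong\pi_{\mathbb{Z}}^{alg}\big(C(X)\big)\cong\pi_{1}\big(C(X,X),id_{X}\big).$$
   Context: $C(X)$ is the ring of real-valued continuous functions on $X$, and $C(X,X)$ is the space of continuous self-maps of $X$ with the compact-open topology. All rings are commutative with unity. A pm-ring is a ring in which every prime ideal is contained in a unique maximal ideal ($C(X)$ is a pm-ring). $\mathrm{Spec}(A)$ carries the Zariski topology and $\mathrm{Max}(A)$ the subspace topology; for a pm-ring $A$ let $\mu:\mathrm{Spec}(A)\to\mathrm{Max}(A)$ send each prime to the unique maximal ideal containing it (this is a continuous retraction, and $\mathrm{Max}(A)$ is compact Hausdorff). Let $k$ be $\mathbb{Z}$ or $\mathbb{R}$, and let $A$ be a pm-ring with a $k$-algebra structure. $E_k(A)$ is the monoid of unital $k$-algebra endomorphisms of $A$. For $f\in E_k(A)$, the induced spectral map $\mu_f:\mathrm{Max}(A)\to\mathrm{Max}(A)$ is the continuous map $\mu_f(M)=\mu(f^{-1}(M))$. Put $X_k^A=\{\mu_f : f\in E_k(A)\}$, with the subspace topology from the space $C(\mathrm{Max}(A),\mathrm{Max}(A))$ of continuous self-maps with the compact-open topology. The spectral fundamental group of $A$ is $\pi_k^{alg}(A):=\pi_1(X_k^A,\mu_{id_A})$, i.e. based-homotopy classes of loops in $X_k^A$ at $\mu_{id_A}$ (the identity map of $\mathrm{Max}(A)$), with the operation induced by concatenation. *)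

theory Defs
  imports
    "HOL-Analysis.Analysis"
    "HOL-Algebra.Ideal"
    "HOL-Algebra.Module"
    "HOL-Algebra.IntRing"
begin

section \<open>The fundamental group of an abstract topology\<close>

text \<open>A loop is a function on all of \<^typ>\<open>real\<close> of which only the values on \<open>[0,1]\<close> matter:
  loops that agree on \<open>[0,1]\<close> are homotopic, so they represent the same class. The library's
  \<open>joinpaths\<close> does not apply, since it needs a topological type class instance.\<close>

definition loops_at :: "'a topology \<Rightarrow> 'a \<Rightarrow> (real \<Rightarrow> 'a) set" where
  "loops_at T x = {p. pathin T p \<and> p 0 = x \<and> p 1 = x}"

definition loop_homotopy_rel :: "'a topology \<Rightarrow> 'a \<Rightarrow> ((real \<Rightarrow> 'a) \<times> (real \<Rightarrow> 'a)) set" where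
  "loop_homotopy_rel T x =
     {(p, q). homotopic_with (\<lambda>g. g 0 = x \<and> g 1 = x) (top_of_set {0..1}) T p q}"

definition loop_concat :: "(real \<Rightarrow> 'a) \<Rightarrow> (real \<Rightarrow> 'a) \<Rightarrow> real \<Rightarrow> 'a" where
  "loop_concat p q = (\<lambda>t. if t \<le> 1/2 then p (2 * t) else q (2 * t - 1))"

definition fundamental_group :: "'a topology \<Rightarrow> 'a \<Rightarrow> (real \<Rightarrow> 'a) set monoid" where
  "fundamental_group T x =
     \<lparr>carrier = loops_at T x // loop_homotopy_rel T x,
      monoid.mult = (\<lambda>a b. \<Union>p\<in>a. \<Union>q\<in>b. loop_homotopy_rel T x `` {loop_concat p q}),
      one = loop_homotopy_rel T x `` {\<lambda>_. x}\<rparr>"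

lemma equiv_loop_homotopy_rel: "equiv (loops_at T x) (loop_homotopy_rel T x)"
proof (rule equivI)
  show "loop_homotopy_rel T x \<subseteq> loops_at T x \<times> loops_at T x"
    using homotopic_with_imp_continuous_maps homotopic_with_imp_property
    unfolding loops_at_def loop_homotopy_rel_def pathin_def by blast
  show "refl_on (loops_at T x) (loop_homotopy_rel T x)"
    by (auto simp: loops_at_def loop_homotopy_rel_def pathin_def refl_on_def)
  show "sym (loop_homotopy_rel T x)"
    by (auto simp: sym_def loop_homotopy_rel_def homotopic_with_sym)
  show "trans (loop_homotopy_rel T x)"
    unfolding trans_def loop_homotopy_rel_def by (blast intro: homotopic_with_trans)
qed

lemma loop_homotopy_relI:
  assumes "continuous_map (prod_topology (top_of_set {0..1::real}) (top_of_set {0..1::real})) T h"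
    and "\<And>t. t \<in> {0..1} \<Longrightarrow> h (0, t) = p t" "\<And>t. t \<in> {0..1} \<Longrightarrow> h (1, t) = q t"
    and "\<And>s. s \<in> {0..1} \<Longrightarrow> h (s, 0) = x \<and> h (s, 1) = x"
  shows "(p, q) \<in> loop_homotopy_rel T x"
proof -
  let ?P = "\<lambda>g. g 0 = x \<and> g 1 = x"
  have "homotopic_with ?P (top_of_set {0..1}) T p q"
    by (subst homotopic_with) (use assms in \<open>auto intro: exI[of _ h]\<close>)
  then show ?thesis
    by (simp add: loop_homotopy_rel_def)
qed

lemma loop_homotopy_reparam:
  assumes "pathin T p"
    and "continuous_on {0..1} f" "continuous_on {0..1} g" "f ` {0..1} \<subseteq> {0..1}" "g ` {0..1} \<subseteq> {0..1}"
    and "f 0 = g 0" "f 1 = g 1" "p (f 0) = x" "p (f 1) = x"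
    and "\<And>t. t \<in> {0..1} \<Longrightarrow> q t = p (f t)" "\<And>t. t \<in> {0..1} \<Longrightarrow> r t = p (g t)"
  shows "(q, r) \<in> loop_homotopy_rel T x"
proof (rule loop_homotopy_relI)
  let ?k = "\<lambda>z. (1 - fst z) * f (snd z) + fst z * g (snd z)"
  have "continuous_on ({0..1} \<times> {0..1}) (\<lambda>z. f (snd z))" "continuous_on ({0..1} \<times> {0..1}) (\<lambda>z. g (snd z))"
    by (intro continuous_on_compose2[OF assms(2)] continuous_on_compose2[OF assms(3)] continuous_intros; force)+
  then have "continuous_on ({0..1} \<times> {0..1}) ?k"
    by (intro continuous_intros)
  moreover have "(1 - s) * f t + s * g t \<in> {0..1}" if "s \<in> {0..1}" "t \<in> {0..1}" for s t
  proof -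
    have "f t \<in> {0..1}" "g t \<in> {0..1}"
      using assms(4,5) that by blast+
    then show ?thesis
      using that convexD[of "{0..1::real}" "f t" "g t" "1 - s" s] by simp
  qed
  ultimately have "continuous_map (top_of_set ({0..1} \<times> {0..1})) (top_of_set {0..1}) ?k"
    by (auto simp: continuous_map_in_subtopology)
  then have "continuous_map (top_of_set ({0..1} \<times> {0..1})) T (p \<circ> ?k)"
    using assms(1) continuous_map_compose unfolding pathin_def by blast
  then show "continuous_map (prod_topology (top_of_set {0..1}) (top_of_set {0..1})) T (p \<circ> ?k)"
    by (simp add: subtopology_Times flip: euclidean_product_topology prod_topology_subtopology(1))
qed (use assms in \<open>auto simp: algebra_simps\<close>)

lemma loop_concat_cong:
  assumes "(p, p') \<in> loop_homotopy_rel T x" "(q, q') \<in> loop_homotopy_rel T x"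
  shows "(loop_concat p q, loop_concat p' q') \<in> loop_homotopy_rel T x"
proof -
  let ?I = "top_of_set {0..1::real}"
  obtain h where h: "continuous_map (prod_topology ?I ?I) T h" "\<And>t. h (0, t) = p t" "\<And>t. h (1, t) = p' t"
    "\<And>s. s \<in> {0..1} \<Longrightarrow> h (s, 0) = x \<and> h (s, 1) = x"
    using assms(1) unfolding loop_homotopy_rel_def homotopic_with_def by auto
  obtain k where k: "continuous_map (prod_topology ?I ?I) T k" "\<And>t. k (0, t) = q t" "\<And>t. k (1, t) = q' t"
    "\<And>s. s \<in> {0..1} \<Longrightarrow> k (s, 0) = x \<and> k (s, 1) = x"
    using assms(2) unfolding loop_homotopy_rel_def homotopic_with_def by auto
  have eq: "prod_topology ?I ?I = top_of_set ({0..1} \<times> {0..1})"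
    by (simp add: subtopology_Times flip: euclidean_product_topology prod_topology_subtopology(1))
  let ?Z = "{0..1} \<times> {0..1} :: (real \<times> real) set"
  have "continuous_map (top_of_set ?Z) T
          (\<lambda>z. if snd z \<le> 1/2 then (h \<circ> (\<lambda>z. (fst z, 2 * snd z))) z
               else (k \<circ> (\<lambda>z. (fst z, 2 * snd z - 1))) z)"
  proof (rule continuous_map_cases_le)
    show "continuous_map (subtopology (top_of_set ?Z) {z \<in> topspace (top_of_set ?Z). snd z \<le> 1/2}) T
            (h \<circ> (\<lambda>z. (fst z, 2 * snd z)))"
      by (rule continuous_map_compose[OF _ h(1)[unfolded eq]])
        (auto simp: continuous_map_in_subtopology subtopology_subtopology intro!: continuous_intros)
    show "continuous_map (subtopology (top_of_set ?Z) {z \<in> topspace (top_of_set ?Z). 1/2 \<le> snd z}) T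
            (k \<circ> (\<lambda>z. (fst z, 2 * snd z - 1)))"
      by (rule continuous_map_compose[OF _ k(1)[unfolded eq]])
        (auto simp: continuous_map_in_subtopology subtopology_subtopology intro!: continuous_intros)
    show "(h \<circ> (\<lambda>z. (fst z, 2 * snd z))) z = (k \<circ> (\<lambda>z. (fst z, 2 * snd z - 1))) z"
      if "z \<in> topspace (top_of_set ?Z)" "snd z = 1/2" for z
    proof -
      from that(2) have "2 * snd z = 1"
        by simp
      then show ?thesis
        using that(1) h(4)[of "fst z"] k(4)[of "fst z"] by (simp add: mem_Times_iff)
    qed
  qed (auto intro!: continuous_intros)
  then show ?thesis
    by (rule loop_homotopy_relI[OF _, unfolded eq]) (use h k in \<open>auto simp: loop_concat_def\<close>)
qed

lemma loop_concat_in_loops: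
  assumes "p \<in> loops_at T x" "q \<in> loops_at T x"
  shows "loop_concat p q \<in> loops_at T x"
proof -
  have "(p, p) \<in> loop_homotopy_rel T x" "(q, q) \<in> loop_homotopy_rel T x"
    using assms by (simp_all add: loops_at_def loop_homotopy_rel_def pathin_def)
  then have "(loop_concat p q, loop_concat p q) \<in> loop_homotopy_rel T x"
    by (rule loop_concat_cong)
  then show ?thesis
    using equiv_loop_homotopy_rel[of T x] unfolding equiv_def by blast
qed

lemma fundamental_group_mult_class:
  assumes "p \<in> loops_at T x" "q \<in> loops_at T x"
  shows "(loop_homotopy_rel T x `` {p}) \<otimes>\<^bsub>fundamental_group T x\<^esub> (loop_homotopy_rel T x `` {q}) =
    loop_homotopy_rel T x `` {loop_concat p q}"
proof -
  have "congruent2 (loop_homotopy_rel T x) (loop_homotopy_rel T x)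
          (\<lambda>p q. loop_homotopy_rel T x `` {loop_concat p q})"
    using loop_concat_cong equiv_class_eq[OF equiv_loop_homotopy_rel]
    by (fastforce simp: congruent2_def)
  from UN_equiv_class2[OF equiv_loop_homotopy_rel equiv_loop_homotopy_rel this assms]
  show ?thesis
    by (simp add: fundamental_group_def)
qed

lemma group_fundamental_group:
  assumes "x \<in> topspace T"
  shows "group (fundamental_group T x)"
proof -
  let ?R = "loop_homotopy_rel T x" and ?L = "loops_at T x"
  note cl = equiv_class_eq[OF equiv_loop_homotopy_rel[of T x]]
  have carr: "carrier (fundamental_group T x) = ?L // ?R"
    by (simp add: fundamental_group_def)
  have one: "\<one>\<^bsub>fundamental_group T x\<^esub> = ?R `` {\<lambda>_. x}"
    by (simp add: fundamental_group_def)
  have const: "(\<lambda>_. x) \<in> ?L"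
    using assms by (simp add: loops_at_def)
  have assoc: "(loop_concat (loop_concat p q) r, loop_concat p (loop_concat q r)) \<in> ?R"
    if "p \<in> ?L" "q \<in> ?L" "r \<in> ?L" for p q r
  proof (rule loop_homotopy_reparam)
    let ?f = "\<lambda>t::real. min (2 * t) (min (t + 1/4) ((t + 1) / 2))"
    have L: "loop_concat p (loop_concat q r) \<in> ?L"
      by (intro loop_concat_in_loops that)
    then show "pathin T (loop_concat p (loop_concat q r))"
      by (simp add: loops_at_def)
    show "continuous_on {0..1} ?f"
      by (intro continuous_intros) auto
    show "?f ` {0..1} \<subseteq> {0..1}"
      by (auto simp: min_def)
    show "continuous_on {0..1} (\<lambda>t::real. t)" "(\<lambda>t::real. t) ` {0..1} \<subseteq> {0..1}"
      by auto
    show "?f 0 = 0" "?f 1 = 1"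
      by auto
    show "loop_concat p (loop_concat q r) (?f 0) = x" "loop_concat p (loop_concat q r) (?f 1) = x"
      using L by (auto simp: loops_at_def)
    show "loop_concat (loop_concat p q) r t = loop_concat p (loop_concat q r) (?f t)" for t
    proof -
      consider "t \<le> 1/4" | "1/4 < t" "t \<le> 1/2" | "1/2 < t"
        by linarith
      then show ?thesis
      proof cases
        case 1
        then have "?f t = 2 * t" by (simp add: min_def)
        then show ?thesis
          using 1 by (simp add: loop_concat_def)
      next
        case 2
        then have "?f t = t + 1/4" by (auto simp: min_def)
        then show ?thesis
          using 2 by (simp add: loop_concat_def algebra_simps)
      next
        case 3
        then have "?f t = (t + 1) / 2" by (auto simp: min_def)
        then show ?thesis
          using 3 by (simp add: loop_concat_def add_divide_distrib algebra_simps)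
      qed
    qed
  qed auto
  have unit: "(loop_concat (\<lambda>_. x) p, p) \<in> ?R" if "p \<in> ?L" for p
  proof (rule loop_homotopy_reparam[where p = p and f = "\<lambda>t. max 0 (2 * t - 1)" and g = "\<lambda>t. t"])
    show "continuous_on {0..1} (\<lambda>t::real. max 0 (2 * t - 1))"
      by (intro continuous_intros)
    show "loop_concat (\<lambda>_. x) p t = p (max 0 (2 * t - 1))" for t
    proof (cases "t \<le> 1/2")
      case True
      then have "max 0 (2 * t - 1) = 0" by simp
      with True that show ?thesis by (simp only: loop_concat_def loops_at_def mem_Collect_eq if_True)
    next
      case False
      then show ?thesis by (simp add: loop_concat_def max_def)
    qed
  qed (use that in \<open>auto simp: loops_at_def\<close>)
  have inv: "(\<lambda>t. p (1 - t)) \<in> ?L \<and> (loop_concat (\<lambda>t. p (1 - t)) p, \<lambda>_. x) \<in> ?R" if "p \<in> ?L" for p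
  proof
    have "continuous_map (top_of_set {0..1}) (top_of_set {0..1}) (\<lambda>t::real. 1 - t)"
      by (auto simp: continuous_map_in_subtopology intro!: continuous_intros)
    then have "continuous_map (top_of_set {0..1}) T (p \<circ> (\<lambda>t. 1 - t))"
      by (rule continuous_map_compose) (use that in \<open>simp add: loops_at_def pathin_def\<close>)
    then show "(\<lambda>t. p (1 - t)) \<in> ?L"
      using that by (simp add: loops_at_def pathin_def o_def)
    show "(loop_concat (\<lambda>t. p (1 - t)) p, \<lambda>_. x) \<in> ?R"
    proof (rule loop_homotopy_reparam[where p = p and f = "\<lambda>t. \<bar>2 * t - 1\<bar>" and g = "\<lambda>t. 1"])
      show "continuous_on {0..1} (\<lambda>t::real. \<bar>2 * t - 1\<bar>)"
        by (intro continuous_intros)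
      show "loop_concat (\<lambda>t. p (1 - t)) p t = p \<bar>2 * t - 1\<bar>" for t
      proof (cases "t \<le> 1/2")
        case True
        then have "\<bar>2 * t - 1\<bar> = 1 - 2 * t" by linarith
        with True show ?thesis by (simp only: loop_concat_def if_True)
      next
        case False
        then show ?thesis by (simp add: loop_concat_def)
      qed
    qed (use that in \<open>auto simp: loops_at_def\<close>)
  qed
  show ?thesis
  proof (rule groupI, unfold carr one)
    show "?R `` {\<lambda>_. x} \<in> ?L // ?R"
      using const by (rule quotientI)
  next
    fix a b assume "a \<in> ?L // ?R" "b \<in> ?L // ?R"
    then obtain p q where p: "p \<in> ?L" "a = ?R `` {p}" and q: "q \<in> ?L" "b = ?R `` {q}"
      by (elim quotientE)
    show "a \<otimes>\<^bsub>fundamental_group T x\<^esub> b \<in> ?L // ?R"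
      using p(1) q(1) unfolding p(2) q(2)
      by (simp only: fundamental_group_mult_class) (intro quotientI loop_concat_in_loops)
  next
    fix a b c assume "a \<in> ?L // ?R" "b \<in> ?L // ?R" "c \<in> ?L // ?R"
    then obtain p q r where p: "p \<in> ?L" "a = ?R `` {p}" and q: "q \<in> ?L" "b = ?R `` {q}"
      and r: "r \<in> ?L" "c = ?R `` {r}"
      by (elim quotientE)
    show "a \<otimes>\<^bsub>fundamental_group T x\<^esub> b \<otimes>\<^bsub>fundamental_group T x\<^esub> c =
        a \<otimes>\<^bsub>fundamental_group T x\<^esub> (b \<otimes>\<^bsub>fundamental_group T x\<^esub> c)"
      using p(1) q(1) r(1) unfolding p(2) q(2) r(2)
      by (simp only: fundamental_group_mult_class loop_concat_in_loops cl[OF assoc])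
  next
    fix a assume "a \<in> ?L // ?R"
    then obtain p where p: "p \<in> ?L" "a = ?R `` {p}"
      by (elim quotientE)
    show "?R `` {\<lambda>_. x} \<otimes>\<^bsub>fundamental_group T x\<^esub> a = a"
      unfolding p(2) using p(1) by (simp only: fundamental_group_mult_class const cl[OF unit])
  next
    fix a assume "a \<in> ?L // ?R"
    then obtain p where p: "p \<in> ?L" "a = ?R `` {p}"
      by (elim quotientE)
    have "?R `` {\<lambda>t. p (1 - t)} \<otimes>\<^bsub>fundamental_group T x\<^esub> a = ?R `` {\<lambda>_. x}"
      unfolding p(2) using p(1) inv[OF p(1)] by (simp only: fundamental_group_mult_class cl)
    moreover have "?R `` {\<lambda>t. p (1 - t)} \<in> ?L // ?R"
      using inv[OF p(1)] by (blast intro: quotientI)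
    ultimately show "\<exists>b\<in>?L // ?R. b \<otimes>\<^bsub>fundamental_group T x\<^esub> a = ?R `` {\<lambda>_. x}"
      by blast
  qed
qed


section \<open>The compact-open topology\<close>

text \<open>Maps are taken to be \<^const>\<open>extensional\<close>, so that each continuous map is represented by
  exactly one function.\<close>

definition cont_maps :: "'a topology \<Rightarrow> 'b topology \<Rightarrow> ('a \<Rightarrow> 'b) set" where
  "cont_maps X Y = {f. continuous_map X Y f \<and> f \<in> extensional (topspace X)}"

definition compact_open_topology :: "'a topology \<Rightarrow> 'b topology \<Rightarrow> ('a \<Rightarrow> 'b) topology" where
  "compact_open_topology X Y =
     topology_generated_by {{f \<in> cont_maps X Y. f ` K \<subseteq> U} |K U. compactin X K \<and> openin Y U}"

lemma topspace_compact_open_topology: "topspace (compact_open_topology X Y) = cont_maps X Y"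
proof -
  have "cont_maps X Y \<in> {{f \<in> cont_maps X Y. f ` K \<subseteq> U} |K U. compactin X K \<and> openin Y U}"
    by (rule CollectI, intro exI[of _ "{}"]) auto
  then show ?thesis
    unfolding compact_open_topology_def topology_generated_by_topspace by blast
qed


section \<open>Spectra and pm-rings\<close>

definition pm_ring :: "('a, 'm) ring_scheme \<Rightarrow> bool" where
  "pm_ring R \<longleftrightarrow> cring R \<and> (\<forall>P. primeideal P R \<longrightarrow> (\<exists>!M. maximalideal M R \<and> P \<subseteq> M))"

definition prime_spec :: "('a, 'm) ring_scheme \<Rightarrow> 'a set set" where
  "prime_spec R = {P. primeideal P R}"

definition max_spec :: "('a, 'm) ring_scheme \<Rightarrow> 'a set set" where
  "max_spec R = {M. maximalideal M R}"

definition zariski_topology :: "('a, 'm) ring_scheme \<Rightarrow> 'a set topology" where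
  "zariski_topology R =
     topology (\<lambda>U. \<exists>S \<subseteq> carrier R. U = prime_spec R - {P \<in> prime_spec R. S \<subseteq> P})"

definition max_topology :: "('a, 'm) ring_scheme \<Rightarrow> 'a set topology" where
  "max_topology R = subtopology (zariski_topology R) (max_spec R)"

text \<open>Meaningful only when \<^term>\<open>R\<close> is a pm-ring, where the maximal ideal is unique.\<close>

definition pm_retraction :: "('a, 'm) ring_scheme \<Rightarrow> 'a set \<Rightarrow> 'a set" where
  "pm_retraction R P = (THE M. maximalideal M R \<and> P \<subseteq> M)"

lemma openin_zariski_topology:
  assumes "cring R"
  shows "openin (zariski_topology R) U \<longleftrightarrow>
    (\<exists>S \<subseteq> carrier R. U = prime_spec R - {P \<in> prime_spec R. S \<subseteq> P})"
proof -
  interpret cring R by fact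
  let ?O = "\<lambda>S. prime_spec R - {P \<in> prime_spec R. S \<subseteq> P}"
  have Int: "\<exists>W \<subseteq> carrier R. ?O S \<inter> ?O T = ?O W" if "S \<subseteq> carrier R" "T \<subseteq> carrier R" for S T
  proof (intro exI conjI)
    show "{s \<otimes>\<^bsub>R\<^esub> t |s t. s \<in> S \<and> t \<in> T} \<subseteq> carrier R"
      using that by auto
    have "S \<subseteq> P \<or> T \<subseteq> P \<longleftrightarrow> {s \<otimes>\<^bsub>R\<^esub> t |s t. s \<in> S \<and> t \<in> T} \<subseteq> P" if "primeideal P R" for P
    proof -
      interpret P: primeideal P R by fact
      show ?thesis
      proof
        assume "S \<subseteq> P \<or> T \<subseteq> P"
        then show "{s \<otimes>\<^bsub>R\<^esub> t |s t. s \<in> S \<and> t \<in> T} \<subseteq> P"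
          using \<open>S \<subseteq> carrier R\<close> \<open>T \<subseteq> carrier R\<close> P.I_l_closed P.I_r_closed by blast
      next
        assume "{s \<otimes>\<^bsub>R\<^esub> t |s t. s \<in> S \<and> t \<in> T} \<subseteq> P"
        then show "S \<subseteq> P \<or> T \<subseteq> P"
          using \<open>S \<subseteq> carrier R\<close> \<open>T \<subseteq> carrier R\<close> P.I_prime by blast
      qed
    qed
    then show "?O S \<inter> ?O T = ?O {s \<otimes>\<^bsub>R\<^esub> t |s t. s \<in> S \<and> t \<in> T}"
      unfolding prime_spec_def by blast
  qed
  have Un: "\<exists>W \<subseteq> carrier R. \<Union>\<K> = ?O W" if K: "\<forall>V\<in>\<K>. \<exists>S \<subseteq> carrier R. V = ?O S" for \<K>
  proof -
    obtain F where F: "\<And>V. V \<in> \<K> \<Longrightarrow> F V \<subseteq> carrier R" "\<And>V. V \<in> \<K> \<Longrightarrow> V = ?O (F V)"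
      using bchoice[OF K] by blast
    have "\<Union>\<K> = (\<Union>V\<in>\<K>. V)"
      by simp
    also have "\<dots> = (\<Union>V\<in>\<K>. ?O (F V))"
      using refl F(2) by (rule SUP_cong)
    also have "\<dots> = ?O (\<Union>V\<in>\<K>. F V)"
      by auto
    finally have "\<Union>\<K> = ?O (\<Union>V\<in>\<K>. F V)" .
    moreover have "(\<Union>V\<in>\<K>. F V) \<subseteq> carrier R"
      using F(1) by (rule UN_least)
    ultimately show ?thesis
      by (intro exI conjI)
  qed
  have "istopology (\<lambda>U. \<exists>S \<subseteq> carrier R. U = ?O S)"
    unfolding istopology_def
  proof (intro conjI allI impI)
    show "\<exists>W \<subseteq> carrier R. U \<inter> V = ?O W"
      if "\<exists>S \<subseteq> carrier R. U = ?O S" "\<exists>S \<subseteq> carrier R. V = ?O S" for U V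
    proof -
      from that obtain S T where S: "S \<subseteq> carrier R" "U = ?O S" and T: "T \<subseteq> carrier R" "V = ?O T"
        by (elim exE conjE)
      show ?thesis
        unfolding S(2) T(2) using S(1) T(1) by (rule Int)
    qed
  qed (rule Un)
  then show ?thesis
    by (simp add: zariski_topology_def)
qed


section \<open>The spectral fundamental group\<close>

definition algebra_endos :: "('k, 'm) ring_scheme \<Rightarrow> ('k, 'a) module \<Rightarrow> ('a \<Rightarrow> 'a) set" where
  "algebra_endos k A =
     {f \<in> ring_hom A A. f \<in> extensional (carrier A) \<and>
        (\<forall>c\<in>carrier k. \<forall>a\<in>carrier A. f (c \<odot>\<^bsub>A\<^esub> a) = c \<odot>\<^bsub>A\<^esub> f a)}"

definition spectral_map :: "('a, 'm) ring_scheme \<Rightarrow> ('a \<Rightarrow> 'a) \<Rightarrow> 'a set \<Rightarrow> 'a set" where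
  "spectral_map A f = (\<lambda>M\<in>max_spec A. pm_retraction A (f -` M \<inter> carrier A))"

definition spectral_maps_topology ::
    "('k, 'm) ring_scheme \<Rightarrow> ('k, 'a) module \<Rightarrow> ('a set \<Rightarrow> 'a set) topology" where
  "spectral_maps_topology k A =
     subtopology (compact_open_topology (max_topology A) (max_topology A))
       (spectral_map A ` algebra_endos k A)"

definition spectral_fundamental_group ::
    "('k, 'm) ring_scheme \<Rightarrow> ('k, 'a) module \<Rightarrow> (real \<Rightarrow> 'a set \<Rightarrow> 'a set) set monoid" where
  "spectral_fundamental_group k A =
     fundamental_group (spectral_maps_topology k A) (spectral_map A (\<lambda>a\<in>carrier A. a))"


lemma topspace_max_topology:
  assumes "cring R"
  shows "topspace (max_topology R) = max_spec R"
proof -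
  interpret cring R by fact
  have "\<not> carrier R \<subseteq> P" if "P \<in> prime_spec R" for P
  proof -
    interpret primeideal P R
      using that by (simp add: prime_spec_def)
    show ?thesis
      using I_notcarr a_subset by (metis subset_antisym)
  qed
  then have "prime_spec R = prime_spec R - {P \<in> prime_spec R. carrier R \<subseteq> P}"
    by auto
  then have "openin (zariski_topology R) (prime_spec R)"
    unfolding openin_zariski_topology[OF assms] by (intro exI[of _ "carrier R"] conjI subset_refl)
  then have "prime_spec R \<subseteq> topspace (zariski_topology R)"
    by (rule openin_subset)
  moreover have "max_spec R \<subseteq> prime_spec R"
    using maximalideal_prime by (auto simp: max_spec_def prime_spec_def)
  ultimately show ?thesis
    by (auto simp: max_topology_def)
qed

lemma pm_retraction_maximal:
  assumes "pm_ring R" "M \<in> max_spec R"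
  shows "pm_retraction R M = M"
proof -
  have M: "maximalideal M R"
    using assms(2) by (simp add: max_spec_def)
  then have "primeideal M R"
    using assms(1) cring.maximalideal_prime by (auto simp: pm_ring_def)
  then have "\<exists>!N. maximalideal N R \<and> M \<subseteq> N"
    using assms(1) by (simp add: pm_ring_def)
  then show ?thesis
    unfolding pm_retraction_def using M by (intro the1_equality) auto
qed

lemma spectral_map_id:
  assumes "pm_ring A"
  shows "spectral_map A (\<lambda>a\<in>carrier A. a) = (\<lambda>M\<in>max_spec A. M)"
  unfolding spectral_map_def
proof (rule restrict_ext)
  fix M assume M: "M \<in> max_spec A"
  then have "M \<subseteq> carrier A"
    by (simp add: max_spec_def additive_subgroup.a_subset ideal.axioms(1) maximalideal.axioms(1))
  then have "(\<lambda>a\<in>carrier A. a) -` M \<inter> carrier A = M"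
    by auto
  with pm_retraction_maximal[OF assms M]
  show "pm_retraction A ((\<lambda>a\<in>carrier A. a) -` M \<inter> carrier A) = M"
    by simp
qed

lemma group_spectral_fundamental_group:
  assumes "algebra k A" "pm_ring A"
  shows "group (spectral_fundamental_group k A)"
  unfolding spectral_fundamental_group_def
proof (rule group_fundamental_group)
  interpret algebra k A by fact
  have "(\<lambda>a\<in>carrier A. a) \<in> algebra_endos k A"
    by (auto simp: algebra_endos_def ring_hom_def)
  moreover have "spectral_map A (\<lambda>a\<in>carrier A. a) \<in> cont_maps (max_topology A) (max_topology A)"
    unfolding spectral_map_id[OF assms(2)] cont_maps_def topspace_max_topology[OF M_cring]
    using topspace_max_topology[OF M_cring]
    by (auto intro: continuous_map_eq[OF continuous_map_id[unfolded id_def]])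
  ultimately show "spectral_map A (\<lambda>a\<in>carrier A. a) \<in> topspace (spectral_maps_topology k A)"
    by (auto simp: spectral_maps_topology_def topspace_compact_open_topology)
qed


section \<open>The algebra of continuous real-valued functions\<close>

definition real_ring :: "real ring" where
  "real_ring = \<lparr>carrier = UNIV, monoid.mult = (*), one = 1, zero = 0, add = (+)\<rparr>"

definition cont_ring :: "'a topology \<Rightarrow> ('a \<Rightarrow> real) ring" where
  "cont_ring X =
     \<lparr>carrier = cont_maps X euclideanreal,
      monoid.mult = (\<lambda>f g. \<lambda>x\<in>topspace X. f x * g x),
      one = (\<lambda>x\<in>topspace X. 1),
      zero = (\<lambda>x\<in>topspace X. 0),
      add = (\<lambda>f g. \<lambda>x\<in>topspace X. f x + g x)\<rparr>"

definition cont_real_algebra :: "'a topology \<Rightarrow> (real, 'a \<Rightarrow> real) module" where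
  "cont_real_algebra X =
     ring.extend (cont_ring X) (module.fields (\<lambda>c f. \<lambda>x\<in>topspace X. c * f x))"

text \<open>The unique \<open>\<int>\<close>-algebra structure of a ring.\<close>

definition int_algebra :: "'a ring \<Rightarrow> (int, 'a) module" where
  "int_algebra R = ring.extend R (module.fields (\<lambda>n a. [n] \<cdot>\<^bsub>R\<^esub> a))"

lemma cring_real_ring: "cring real_ring"
proof (intro cringI abelian_groupI comm_monoidI)
  show "\<exists>y\<in>carrier real_ring. y \<oplus>\<^bsub>real_ring\<^esub> a = \<zero>\<^bsub>real_ring\<^esub>" for a
    by (rule bexI[of _ "- a"]) (simp_all add: real_ring_def)
qed (simp_all add: real_ring_def algebra_simps)

lemma restrict_in_cont_maps:
  "continuous_map X Y f \<Longrightarrow> restrict f (topspace X) \<in> cont_maps X Y"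
  unfolding cont_maps_def by (auto intro: continuous_map_eq)

lemma cont_ring_closed:
  assumes "f \<in> cont_maps X euclideanreal" "g \<in> cont_maps X euclideanreal"
  shows "(\<lambda>x\<in>topspace X. f x + g x) \<in> cont_maps X euclideanreal"
    and "(\<lambda>x\<in>topspace X. f x * g x) \<in> cont_maps X euclideanreal"
    and "(\<lambda>x\<in>topspace X. c * f x) \<in> cont_maps X euclideanreal"
  using assms by (auto intro!: restrict_in_cont_maps continuous_map_add continuous_map_real_mult simp: cont_maps_def)

lemma cont_ring_const_closed: "(\<lambda>x\<in>topspace X. c) \<in> cont_maps X euclideanreal"
  by (rule restrict_in_cont_maps) simp

lemma cring_cont_ring: "cring (cont_ring X)"
proof (intro cringI abelian_groupI comm_monoidI)
  show "\<exists>g\<in>carrier (cont_ring X). g \<oplus>\<^bsub>cont_ring X\<^esub> f = \<zero>\<^bsub>cont_ring X\<^esub>" if "f \<in> carrier (cont_ring X)" for f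
  proof (rule bexI[of _ "\<lambda>x\<in>topspace X. - 1 * f x"])
    show "(\<lambda>x\<in>topspace X. - 1 * f x) \<in> carrier (cont_ring X)"
      using that cont_ring_closed(3)[of f X f "-1"] by (simp add: cont_ring_def)
  qed (auto simp: cont_ring_def)
  show "\<zero>\<^bsub>cont_ring X\<^esub> \<oplus>\<^bsub>cont_ring X\<^esub> f = f" "\<one>\<^bsub>cont_ring X\<^esub> \<otimes>\<^bsub>cont_ring X\<^esub> f = f"
    if "f \<in> carrier (cont_ring X)" for f
    using that by (auto simp: cont_ring_def cont_maps_def intro: extensionalityI[of _ "topspace X"])
qed (auto simp: cont_ring_def cont_ring_closed cont_ring_const_closed algebra_simps intro!: restrict_ext)

lemma cring_extend:
  assumes "cring R"
  shows "cring (ring.extend R e)"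
proof -
  interpret cring R by fact
  show ?thesis
  proof (intro cringI abelian_groupI comm_monoidI)
    show "\<exists>b\<in>carrier (ring.extend R e). b \<oplus>\<^bsub>ring.extend R e\<^esub> a = \<zero>\<^bsub>ring.extend R e\<^esub>"
      if "a \<in> carrier (ring.extend R e)" for a
      using that by (intro bexI[of _ "\<ominus>\<^bsub>R\<^esub> a"]) (simp_all add: ring.defs l_neg)
  qed (auto simp: ring.defs a_assoc m_assoc l_distr intro: a_comm m_comm)
qed

lemma algebra_cont_real_algebra: "algebra real_ring (cont_real_algebra X)"
proof (rule algebraI)
  show "cring (cont_real_algebra X)"
    unfolding cont_real_algebra_def by (intro cring_extend cring_cont_ring)
  show "cring real_ring"
    by (rule cring_real_ring)
  show "\<one>\<^bsub>real_ring\<^esub> \<odot>\<^bsub>cont_real_algebra X\<^esub> f = f" if "f \<in> carrier (cont_real_algebra X)" for f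
    using that by (auto simp: cont_real_algebra_def cont_ring_def real_ring_def ring.defs module.defs
        cont_maps_def intro: extensionalityI[of _ "topspace X"])
qed (auto simp: cont_real_algebra_def cont_ring_def real_ring_def ring.defs module.defs
    cont_ring_closed algebra_simps intro!: restrict_ext)

lemma algebra_int_algebra:
  assumes "cring R"
  shows "algebra \<Z> (int_algebra R)"
proof -
  interpret cring R by fact
  show ?thesis
  proof (rule algebraI)
    show "cring (int_algebra R)"
      unfolding int_algebra_def by (intro cring_extend assms)
  qed (simp_all add: int_is_cring int_algebra_def ring.defs module.defs add.int_pow_mult
      add.int_pow_distrib add.int_pow_pow add_pow_ldistr_int mult.commute)
qed

lemma (in cring) ideal_subset_maximalideal:
  assumes "ideal I R" "\<one> \<notin> I"
  shows "\<exists>M. maximalideal M R \<and> I \<subseteq> M"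
proof -
  let ?A = "{J. ideal J R \<and> I \<subseteq> J \<and> \<one> \<notin> J}"
  have "\<exists>M\<in>?A. \<forall>J\<in>?A. M \<subseteq> J \<longrightarrow> J = M"
  proof (rule subset_Zorn_nonempty)
    show "?A \<noteq> {}"
      using assms by blast
    fix C assume C: "C \<noteq> {}" "subset.chain ?A C"
    have id: "ideal J R" "I \<subseteq> J" "\<one> \<notin> J" if "J \<in> C" for J
      using C(2) that by (auto simp: subset.chain_def)
    have lin: "J \<subseteq> K \<or> K \<subseteq> J" if "J \<in> C" "K \<in> C" for J K
      using C(2) that by (auto simp: subset.chain_def)
    have "ideal (\<Union>C) R"
    proof (rule idealI)
      show "ring R" ..
      show "subgroup (\<Union>C) (add_monoid R)"
      proof (rule add.subgroupI)
        show "\<Union>C \<subseteq> carrier R"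
          using id(1) additive_subgroup.a_subset ideal.axioms(1) by blast
        show "\<Union>C \<noteq> {}"
          using C(1) id(1) additive_subgroup.zero_closed ideal.axioms(1) by blast
        show "\<ominus> a \<in> \<Union>C" if "a \<in> \<Union>C" for a
        proof -
          from that obtain J where J: "J \<in> C" "a \<in> J" ..
          interpret J: ideal J R using J(1) by (rule id)
          show ?thesis
            using J(1) J.a_inv_closed[OF J(2)] by (rule UnionI)
        qed
        fix a b assume "a \<in> \<Union>C" "b \<in> \<Union>C"
        then obtain J where J: "J \<in> C" "a \<in> J" "b \<in> J"
          using lin by blast
        interpret J: ideal J R using J(1) by (rule id)
        show "a \<oplus> b \<in> \<Union>C"
          using J(1) J.a_closed[OF J(2,3)] by (rule UnionI)
      qed
      fix a x assume "a \<in> \<Union>C" and x: "x \<in> carrier R"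
      then obtain J where J: "J \<in> C" "a \<in> J"
        by blast
      interpret J: ideal J R using J(1) by (rule id)
      show "x \<otimes> a \<in> \<Union>C" "a \<otimes> x \<in> \<Union>C"
        using J.I_l_closed[OF J(2) x] J.I_r_closed[OF J(2) x] J(1) by blast+
    qed
    then show "\<Union>C \<in> ?A"
      using C(1) id by blast
  qed
  then obtain M where M: "ideal M R" "I \<subseteq> M" "\<one> \<notin> M"
    and max: "\<And>J. ideal J R \<Longrightarrow> M \<subseteq> J \<Longrightarrow> \<one> \<notin> J \<Longrightarrow> J = M"
    by (auto dest: order_trans)
  have "maximalideal M R"
  proof (rule maximalidealI)
    show "carrier R \<noteq> M"
      using M(3) by blast
    show "J = M \<or> J = carrier R" if "ideal J R" "M \<subseteq> J" for J
      using that max ideal.one_imp_carrier by blast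
  qed fact
  with M(2) show ?thesis
    by blast
qed

lemma pm_ring_cont_ring: "pm_ring (cont_ring X)"
  unfolding pm_ring_def
proof (intro conjI allI impI)
  let ?R = "cont_ring X"
  interpret cring ?R by (rule cring_cont_ring)
  have unit: "\<one>\<^bsub>?R\<^esub> \<in> I" if I: "ideal I ?R" and u: "u \<in> I" "\<And>x. x \<in> topspace X \<Longrightarrow> u x > 0" for I u
  proof -
    interpret I: ideal I ?R by fact
    have "u \<in> cont_maps X euclideanreal"
      using I.a_subset u(1) by (auto simp: cont_ring_def)
    then have "continuous_map X euclideanreal (\<lambda>x. inverse (u x))"
      using u(2) by (intro continuous_map_real_inverse) (force simp: cont_maps_def)+
    then have "(\<lambda>x\<in>topspace X. inverse (u x)) \<in> carrier ?R"
      by (simp add: cont_ring_def restrict_in_cont_maps)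
    then have "u \<otimes>\<^bsub>?R\<^esub> (\<lambda>x\<in>topspace X. inverse (u x)) \<in> I"
      using u(1) by (rule I.I_r_closed[rotated])
    also have "u \<otimes>\<^bsub>?R\<^esub> (\<lambda>x\<in>topspace X. inverse (u x)) = \<one>\<^bsub>?R\<^esub>"
      using less_imp_neq[OF u(2)] by (force simp: cont_ring_def intro!: restrict_ext)
    finally show ?thesis .
  qed
  show "cring ?R" ..
  fix P assume "primeideal P ?R"
  then interpret P: primeideal P ?R .
  have "\<one>\<^bsub>?R\<^esub> \<notin> P"
    using P.I_notcarr P.one_imp_carrier by blast
  then obtain M where M: "maximalideal M ?R" "P \<subseteq> M"
    using ideal_subset_maximalideal P.ideal_axioms by blast
  have "N = M" if N: "maximalideal N ?R" "P \<subseteq> N" for N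
  proof (rule ccontr)
    assume "N \<noteq> M"
    interpret M: maximalideal M ?R by fact
    interpret N: maximalideal N ?R by fact
    have sum: "ideal (M <+>\<^bsub>?R\<^esub> N) ?R"
      by (rule add_ideals) (rule M.ideal_axioms N.ideal_axioms)+
    interpret S: ideal "M <+>\<^bsub>?R\<^esub> N" ?R by fact
    have "M \<subseteq> M <+>\<^bsub>?R\<^esub> N"
    proof
      fix a assume "a \<in> M"
      then have "a = a \<oplus>\<^bsub>?R\<^esub> \<zero>\<^bsub>?R\<^esub>"
        by (intro r_zero[symmetric] M.a_Hcarr)
      then show "a \<in> M <+>\<^bsub>?R\<^esub> N"
        unfolding set_add_def' by (intro UN_I[OF \<open>a \<in> M\<close>] UN_I[OF N.zero_closed]) (rule singleton_iff[THEN iffD2])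
    qed
    moreover have "N \<subseteq> M <+>\<^bsub>?R\<^esub> N"
    proof
      fix a assume "a \<in> N"
      then have "a = \<zero>\<^bsub>?R\<^esub> \<oplus>\<^bsub>?R\<^esub> a"
        by (intro l_zero[symmetric] N.a_Hcarr)
      then show "a \<in> M <+>\<^bsub>?R\<^esub> N"
        unfolding set_add_def' by (intro UN_I[OF M.zero_closed] UN_I[OF \<open>a \<in> N\<close>]) (rule singleton_iff[THEN iffD2])
    qed
    ultimately have "M <+>\<^bsub>?R\<^esub> N = carrier ?R"
      using M.I_maximal[OF sum] N.I_maximal[OF sum] S.a_subset \<open>N \<noteq> M\<close> by metis
    then have "\<one>\<^bsub>?R\<^esub> \<in> M <+>\<^bsub>?R\<^esub> N"
      by simp
    then obtain f g where f: "f \<in> M" and g: "g \<in> N" and fg: "\<one>\<^bsub>?R\<^esub> = f \<oplus>\<^bsub>?R\<^esub> g"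
      by (auto simp: set_add_def')
    have sum1: "f x + g x = 1" if "x \<in> topspace X" for x
      using fg that by (auto simp: cont_ring_def dest: fun_cong[of _ _ x])
    have cf: "continuous_map X euclideanreal f"
      using f M.a_subset by (auto simp: cont_ring_def cont_maps_def)
    let ?a = "\<lambda>x\<in>topspace X. max 0 (f x - 1/2)" and ?b = "\<lambda>x\<in>topspace X. max 0 (1/2 - f x)"
    have ab: "?a \<in> carrier ?R" "?b \<in> carrier ?R"
      using cf by (auto simp: cont_ring_def intro!: restrict_in_cont_maps continuous_map_real_max continuous_map_diff)
    have "?a \<otimes>\<^bsub>?R\<^esub> ?b = \<zero>\<^bsub>?R\<^esub>"
      by (auto simp: cont_ring_def max_def intro!: restrict_ext)
    then have "?a \<in> P \<or> ?b \<in> P"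
      using P.I_prime[OF ab] P.zero_closed by simp
    then show False
    proof
      assume "?a \<in> P"
      then have "?a \<oplus>\<^bsub>?R\<^esub> g \<otimes>\<^bsub>?R\<^esub> g \<in> N"
        using N(2) g N.I_l_closed[OF g N.a_Hcarr[OF g]] by (intro N.a_closed) auto
      then have "\<one>\<^bsub>?R\<^esub> \<in> N"
      proof (rule unit[OF N.ideal_axioms])
        fix x assume x: "x \<in> topspace X"
        show "(?a \<oplus>\<^bsub>?R\<^esub> g \<otimes>\<^bsub>?R\<^esub> g) x > 0"
        proof (cases "g x = 0")
          case True
          then have "f x = 1" using sum1[OF x] by simp
          with True show ?thesis using x by (simp add: cont_ring_def)
        next
          case False
          then have "g x * g x > 0" by (simp add: zero_less_mult_iff linorder_neq_iff disj_commute)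
          then show ?thesis using x by (simp add: cont_ring_def add_nonneg_pos)
        qed
      qed
      then show False
        using N.I_notcarr N.one_imp_carrier by blast
    next
      assume "?b \<in> P"
      then have "?b \<oplus>\<^bsub>?R\<^esub> f \<otimes>\<^bsub>?R\<^esub> f \<in> M"
        using M(2) f M.I_l_closed[OF f M.a_Hcarr[OF f]] by (intro M.a_closed) auto
      then have "\<one>\<^bsub>?R\<^esub> \<in> M"
      proof (rule unit[OF M.ideal_axioms])
        fix x assume x: "x \<in> topspace X"
        show "(?b \<oplus>\<^bsub>?R\<^esub> f \<otimes>\<^bsub>?R\<^esub> f) x > 0"
        proof (cases "f x = 0")
          case True
          then show ?thesis using x by (simp add: cont_ring_def)
        next
          case False
          then have "f x * f x > 0" by (simp add: zero_less_mult_iff linorder_neq_iff disj_commute)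
          then show ?thesis using x by (simp add: cont_ring_def add_nonneg_pos)
        qed
      qed
      then show False
        using M.I_notcarr M.one_imp_carrier by blast
    qed
  qed
  with M show "\<exists>!M. maximalideal M ?R \<and> P \<subseteq> M"
    by blast
qed

lemma ideal_extend:
  assumes "cring R"
  shows "ideal I (ring.extend R e) \<longleftrightarrow> ideal I R"
  using assms cring_extend[OF assms, of e]
  unfolding ideal_def ideal_axioms_def additive_subgroup_def subgroup_def m_inv_def cring_def
  by (simp add: ring.defs)

lemma pm_ring_extend:
  assumes "pm_ring R"
  shows "pm_ring (ring.extend R e)"
proof -
  have R: "cring R"
    using assms by (simp add: pm_ring_def)
  have "maximalideal I (ring.extend R e) \<longleftrightarrow> maximalideal I R" for I
    unfolding maximalideal_def maximalideal_axioms_def ideal_extend[OF R] by (simp add: ring.defs)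
  moreover have "primeideal I (ring.extend R e) \<longleftrightarrow> primeideal I R" for I
    using R cring_extend[OF R, of e]
    unfolding primeideal_def primeideal_axioms_def ideal_extend[OF R] by (simp add: ring.defs)
  ultimately show ?thesis
    using assms cring_extend[OF R, of e] by (simp add: pm_ring_def)
qed

lemma group_spectral_fundamental_group_cont:
  "group (spectral_fundamental_group real_ring (cont_real_algebra X))"
  "group (spectral_fundamental_group \<Z> (int_algebra (cont_ring X)))"
  by (intro group_spectral_fundamental_group algebra_cont_real_algebra algebra_int_algebra cring_cont_ring;
      simp add: cont_real_algebra_def int_algebra_def pm_ring_extend pm_ring_cont_ring)+

lemma group_fundamental_group_cont_maps:
  "group (fundamental_group (compact_open_topology X X) (\<lambda>x\<in>topspace X. x))"
  by (rule group_fundamental_group)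
    (simp add: topspace_compact_open_topology restrict_in_cont_maps continuous_map_id[unfolded id_def])

end

theory Submission
  imports Defs
begin

text \<open>Evaluation ties the points of a compact Hausdorff space \<open>X\<close> to the maximal ideals of \<open>C(X)\<close>: a
  proper ideal whose members have no common zero would contain, by compactness, a finite sum of
  squares without zeros, hence a unit; and continuous functions separate points from closed sets.
  So \<open>x \<mapsto> M\<^sub>x = {f. f x = 0}\<close> is a homeomorphism of \<open>X\<close> onto \<open>Max(C(X))\<close>
  (\<open>homeomorphic_map_vanishing_ideal\<close>).

  The key point is that \<^emph>\<open>every\<close> continuous self-map of \<open>Max(C(X))\<close> is spectral. Transported to \<open>X\<close>
  it is a continuous map \<open>g\<close>, and the composition operator \<open>f \<mapsto> f \<circ> g\<close> is an endomorphism of \<open>C(X)\<close>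
  that pulls \<open>M\<^sub>x\<close> back to \<open>M\<^bsub>g x\<^esub>\<close>; that ideal is already maximal, so the retraction fixes it. This
  operator is \<open>\<real>\<close>-linear and a fortiori \<open>\<int>\<close>-linear. Hence for both base rings the space of spectral
  maps is the whole space of continuous self-maps of \<open>Max(C(X))\<close>, and the two spectral fundamental
  groups are equal, not merely isomorphic (\<open>spectral_fundamental_group_cont_ring\<close>).

  It remains to conjugate by the homeomorphism: this is a homeomorphism of the compact-open spaces of
  self-maps (\<open>homeomorphic_maps_compact_open\<close>) that preserves the identity map, so it induces an
  isomorphism of fundamental groups (\<open>fundamental_group_homeomorphic\<close>).\<close>

section \<open>Functoriality of the fundamental group\<close>

lemma loop_homotopy_rel_compose:
  assumes "continuous_map T T' F" "(p, q) \<in> loop_homotopy_rel T x"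
  shows "(F \<circ> p, F \<circ> q) \<in> loop_homotopy_rel T' (F x)"
  using assms unfolding loop_homotopy_rel_def
  by (auto intro: homotopic_with_compose_continuous_map_left)

lemma loops_at_compose:
  assumes "continuous_map T T' F" "p \<in> loops_at T x"
  shows "F \<circ> p \<in> loops_at T' (F x)"
  using assms by (auto simp: loops_at_def pathin_def intro: continuous_map_compose)

text \<open>On the class of \<open>p\<close> this is the class of \<open>F \<circ> p\<close>. The image of a class is a set of loops that need not
  be closed under homotopy, and the relational image closes it without a choice of representative.\<close>

definition induced_on_loop_classes ::
    "'b topology \<Rightarrow> 'b \<Rightarrow> ('a \<Rightarrow> 'b) \<Rightarrow> (real \<Rightarrow> 'a) set \<Rightarrow> (real \<Rightarrow> 'b) set" where
  "induced_on_loop_classes T' y F a = loop_homotopy_rel T' y `` ((\<circ>) F ` a)"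

lemma induced_on_loop_classes_class:
  assumes "continuous_map T T' F" "p \<in> loops_at T x"
  shows "induced_on_loop_classes T' (F x) F (loop_homotopy_rel T x `` {p}) =
    loop_homotopy_rel T' (F x) `` {F \<circ> p}"
proof -
  have "(F \<circ> q, r) \<in> loop_homotopy_rel T' (F x) \<longleftrightarrow> (F \<circ> p, r) \<in> loop_homotopy_rel T' (F x)"
    if "(p, q) \<in> loop_homotopy_rel T x" for q r
    using equiv_class_eq[OF equiv_loop_homotopy_rel loop_homotopy_rel_compose[OF assms(1) that]]
    by blast
  moreover have "(p, p) \<in> loop_homotopy_rel T x"
    using equiv_loop_homotopy_rel[of T x] assms(2) by (simp add: equiv_def refl_on_def)
  ultimately show ?thesis
    unfolding induced_on_loop_classes_def by blast
qed

lemma induced_on_loop_classes_hom: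
  assumes "continuous_map T T' F"
  shows "induced_on_loop_classes T' (F x) F \<in> hom (fundamental_group T x) (fundamental_group T' (F x))"
proof (rule homI)
  fix a assume "a \<in> carrier (fundamental_group T x)"
  then obtain p where p: "p \<in> loops_at T x" "a = loop_homotopy_rel T x `` {p}"
    by (auto simp: fundamental_group_def elim: quotientE)
  then have "F \<circ> p \<in> loops_at T' (F x)"
    using loops_at_compose[OF assms] by blast
  then show "induced_on_loop_classes T' (F x) F a \<in> carrier (fundamental_group T' (F x))"
    using p by (simp add: fundamental_group_def induced_on_loop_classes_class[OF assms] quotientI)
  fix b assume "b \<in> carrier (fundamental_group T x)"
  then obtain q where q: "q \<in> loops_at T x" "b = loop_homotopy_rel T x `` {q}"
    by (auto simp: fundamental_group_def elim: quotientE)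
  have "F \<circ> loop_concat p q = loop_concat (F \<circ> p) (F \<circ> q)"
    by (auto simp: loop_concat_def)
  then show "induced_on_loop_classes T' (F x) F (a \<otimes>\<^bsub>fundamental_group T x\<^esub> b) =
      induced_on_loop_classes T' (F x) F a \<otimes>\<^bsub>fundamental_group T' (F x)\<^esub>
        induced_on_loop_classes T' (F x) F b"
    using p q by (simp add: fundamental_group_mult_class induced_on_loop_classes_class[OF assms]
        loop_concat_in_loops loops_at_compose[OF assms])
qed

text \<open>The loops \<open>G \<circ> F \<circ> p\<close> and \<open>p\<close> may differ outside \<open>[0,1]\<close>, so they are not equal as functions; the
  reparametrisation lemma with identity parameters identifies their classes.\<close>

lemma induced_on_loop_classes_inverse:
  assumes F: "continuous_map T T' F" and G: "continuous_map T' T G"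
    and GF: "\<And>y. y \<in> topspace T \<Longrightarrow> G (F y) = y"
    and x: "x \<in> topspace T" and a: "a \<in> carrier (fundamental_group T x)"
  shows "induced_on_loop_classes T x G (induced_on_loop_classes T' (F x) F a) = a"
proof -
  obtain p where p: "p \<in> loops_at T x" "a = loop_homotopy_rel T x `` {p}"
    using a by (auto simp: fundamental_group_def elim: quotientE)
  have "p t \<in> topspace T" if "t \<in> {0..1}" for t
    using p(1) that by (auto simp: loops_at_def pathin_def dest!: continuous_map_funspace)
  then have "(G \<circ> (F \<circ> p), p) \<in> loop_homotopy_rel T x"
    using p(1) by (intro loop_homotopy_reparam[where p = p and f = "\<lambda>t. t" and g = "\<lambda>t. t"])
      (auto simp: GF loops_at_def)
  then show ?thesis
    using induced_on_loop_classes_class[OF F p(1)]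
      induced_on_loop_classes_class[OF G loops_at_compose[OF F p(1)]]
      equiv_class_eq[OF equiv_loop_homotopy_rel] by (simp add: p(2) GF[OF x])
qed

lemma fundamental_group_homeomorphic:
  assumes hom: "homeomorphic_maps T T' F G" and x: "x \<in> topspace T"
  shows "fundamental_group T x \<cong> fundamental_group T' (F x)"
proof -
  have F: "continuous_map T T' F" and G: "continuous_map T' T G"
    and GF: "\<And>y. y \<in> topspace T \<Longrightarrow> G (F y) = y" and FG: "\<And>y. y \<in> topspace T' \<Longrightarrow> F (G y) = y"
    using hom by (auto simp: homeomorphic_maps_def)
  have Fx: "F x \<in> topspace T'"
    using F x by (auto simp: continuous_map_def)
  have homF: "induced_on_loop_classes T' (F x) F \<in> hom (fundamental_group T x) (fundamental_group T' (F x))"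
    using F by (rule induced_on_loop_classes_hom)
  have homG: "induced_on_loop_classes T x G \<in> hom (fundamental_group T' (F x)) (fundamental_group T x)"
    using induced_on_loop_classes_hom[OF G, of "F x"] by (simp add: GF x)
  have "bij_betw (induced_on_loop_classes T' (F x) F)
      (carrier (fundamental_group T x)) (carrier (fundamental_group T' (F x)))"
  proof (rule bij_betw_byWitness)
    show "\<forall>a\<in>carrier (fundamental_group T x).
        induced_on_loop_classes T x G (induced_on_loop_classes T' (F x) F a) = a"
      using induced_on_loop_classes_inverse[OF F G GF x] by blast
    show "\<forall>b\<in>carrier (fundamental_group T' (F x)).
        induced_on_loop_classes T' (F x) F (induced_on_loop_classes T x G b) = b"
      using induced_on_loop_classes_inverse[OF G F FG Fx] by (simp add: GF x)
  qed (use homF homG in \<open>auto simp: hom_def\<close>)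
  with homF have "induced_on_loop_classes T' (F x) F \<in> iso (fundamental_group T x) (fundamental_group T' (F x))"
    by (simp add: iso_def)
  then show ?thesis
    by (auto simp: is_iso_def)
qed


section \<open>Functoriality of the compact-open topology\<close>

text \<open>It suffices to pull back subbasic open sets: \<open>q \<circ> g \<circ> p\<close> maps a compact set \<open>K\<close> into \<open>U\<close> exactly when
  \<open>g\<close> maps the compact set \<open>p(K)\<close> into the open preimage of \<open>U\<close> under \<open>q\<close>.\<close>

lemma continuous_map_compact_open:
  assumes p: "continuous_map Y X p" and q: "continuous_map X' Y' q"
  shows "continuous_map (compact_open_topology X X') (compact_open_topology Y Y')
    (\<lambda>g. \<lambda>y\<in>topspace Y. q (g (p y)))"
proof -
  let ?F = "\<lambda>g. \<lambda>y\<in>topspace Y. q (g (p y))"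
  have F: "?F g \<in> cont_maps Y Y'" if "g \<in> cont_maps X X'" for g
  proof -
    have "continuous_map X X' g"
      using that by (simp add: cont_maps_def)
    then have "continuous_map Y Y' (q \<circ> (g \<circ> p))"
      using p q by (intro continuous_map_compose)
    from restrict_in_cont_maps[OF this] show ?thesis
      by (simp add: o_def)
  qed
  have pY: "p y \<in> topspace X" if "y \<in> topspace Y" for y
    using p that by (auto simp: continuous_map_def)
  show ?thesis
    unfolding compact_open_topology_def[of Y Y']
  proof (rule continuous_on_generated_topo)
    fix W assume "W \<in> {{f \<in> cont_maps Y Y'. f ` K \<subseteq> U} |K U. compactin Y K \<and> openin Y' U}"
    then obtain K U where W: "W = {f \<in> cont_maps Y Y'. f ` K \<subseteq> U}"
      and K: "compactin Y K" and U: "openin Y' U"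
      by blast
    let ?V = "{z \<in> topspace X'. q z \<in> U}"
    have KY: "K \<subseteq> topspace Y"
      using K by (rule compactin_subset_topspace)
    have eq: "?F g ` K \<subseteq> U \<longleftrightarrow> g ` p ` K \<subseteq> ?V" if "g \<in> cont_maps X X'" for g
    proof -
      have "g (p y) \<in> topspace X'" if "y \<in> K" for y
        using \<open>g \<in> cont_maps X X'\<close> pY KY that by (auto simp: cont_maps_def continuous_map_def)
      then show ?thesis
        using KY by (auto simp: image_subset_iff subset_iff)
    qed
    have "?F -` W \<inter> topspace (compact_open_topology X X') = {g \<in> cont_maps X X'. g ` p ` K \<subseteq> ?V}"
    proof (rule Set.set_eqI)
      show "g \<in> ?F -` W \<inter> topspace (compact_open_topology X X') \<longleftrightarrow>
          g \<in> {g \<in> cont_maps X X'. g ` p ` K \<subseteq> ?V}" for g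
        using F[of g] eq[of g]
        unfolding W topspace_compact_open_topology vimage_eq Int_iff mem_Collect_eq by argo
    qed
    moreover have "openin (compact_open_topology X X') {g \<in> cont_maps X X'. g ` p ` K \<subseteq> ?V}"
      unfolding compact_open_topology_def
      by (rule topology_generated_by_Basis)
        (use image_compactin[OF K p] openin_continuous_map_preimage[OF q U] in blast)
    ultimately show "openin (compact_open_topology X X') (?F -` W \<inter> topspace (compact_open_topology X X'))"
      by simp
  next
    show "?F ` topspace (compact_open_topology X X') \<subseteq>
        \<Union>{{f \<in> cont_maps Y Y'. f ` K \<subseteq> U} |K U. compactin Y K \<and> openin Y' U}"
      using F topspace_compact_open_topology[of X X'] topspace_compact_open_topology[of Y Y']
      unfolding compact_open_topology_def topology_generated_by_topspace by blast
  qed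
qed

lemma homeomorphic_maps_compact_open:
  assumes "homeomorphic_maps X Y p q"
  shows "homeomorphic_maps (compact_open_topology X X) (compact_open_topology Y Y)
    (\<lambda>g. \<lambda>y\<in>topspace Y. p (g (q y))) (\<lambda>h. \<lambda>x\<in>topspace X. q (h (p x)))"
proof -
  have p: "continuous_map X Y p" and q: "continuous_map Y X q"
    and qp: "\<And>x. x \<in> topspace X \<Longrightarrow> q (p x) = x" and pq: "\<And>y. y \<in> topspace Y \<Longrightarrow> p (q y) = y"
    using assms by (auto simp: homeomorphic_maps_def)
  have mem: "p x \<in> topspace Y" if "x \<in> topspace X" for x
    using p that by (auto simp: continuous_map_def)
  have mem': "q y \<in> topspace X" if "y \<in> topspace Y" for y
    using q that by (auto simp: continuous_map_def)
  show ?thesis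
    unfolding homeomorphic_maps_def topspace_compact_open_topology
  proof (intro conjI ballI)
    fix g assume "g \<in> cont_maps X X"
    then show "(\<lambda>x\<in>topspace X. q ((\<lambda>y\<in>topspace Y. p (g (q y))) (p x))) = g"
      by (intro extensionalityI[of _ "topspace X"])
        (auto simp: cont_maps_def continuous_map_def qp mem Pi_iff)
  next
    fix h assume "h \<in> cont_maps Y Y"
    then show "(\<lambda>y\<in>topspace Y. p ((\<lambda>x\<in>topspace X. q (h (p x))) (q y))) = h"
      by (intro extensionalityI[of _ "topspace Y"])
        (auto simp: cont_maps_def continuous_map_def pq mem' Pi_iff)
  qed (intro continuous_map_compact_open p q)+
qed


section \<open>The maximal ideal space of a ring of continuous functions\<close>

definition vanishing_ideal :: "'a topology \<Rightarrow> 'a \<Rightarrow> ('a \<Rightarrow> real) set" where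
  "vanishing_ideal X x = {f \<in> cont_maps X euclideanreal. f x = 0}"

lemma cont_ring_simps:
  "carrier (cont_ring X) = cont_maps X euclideanreal"
  "f \<oplus>\<^bsub>cont_ring X\<^esub> g = (\<lambda>x\<in>topspace X. f x + g x)"
  "f \<otimes>\<^bsub>cont_ring X\<^esub> g = (\<lambda>x\<in>topspace X. f x * g x)"
  "\<zero>\<^bsub>cont_ring X\<^esub> = (\<lambda>x\<in>topspace X. 0)"
  "\<one>\<^bsub>cont_ring X\<^esub> = (\<lambda>x\<in>topspace X. 1)"
  by (simp_all add: cont_ring_def)

lemma ideal_vanishing_ideal:
  assumes x: "x \<in> topspace X"
  shows "ideal (vanishing_ideal X x) (cont_ring X)"
proof -
  interpret cring "cont_ring X" by (rule cring_cont_ring)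
  show ?thesis
  proof (rule idealI)
    show "ring (cont_ring X)" ..
    show "subgroup (vanishing_ideal X x) (add_monoid (cont_ring X))"
    proof (rule add.subgroupI)
      show "vanishing_ideal X x \<subseteq> carrier (cont_ring X)"
        by (auto simp: vanishing_ideal_def cont_ring_simps)
      have "(\<lambda>y\<in>topspace X. 0) \<in> vanishing_ideal X x"
        using x by (simp add: vanishing_ideal_def cont_ring_const_closed)
      then show "vanishing_ideal X x \<noteq> {}"
        by blast
      fix f assume f: "f \<in> vanishing_ideal X x"
      then have fc: "f \<in> carrier (cont_ring X)"
        by (simp add: vanishing_ideal_def cont_ring_simps)
      have "(f \<oplus>\<^bsub>cont_ring X\<^esub> (\<ominus>\<^bsub>cont_ring X\<^esub> f)) x = 0"
        unfolding r_neg[OF fc] using x by (simp add: cont_ring_simps)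
      then show "\<ominus>\<^bsub>cont_ring X\<^esub> f \<in> vanishing_ideal X x"
        using f x a_inv_closed[OF fc] by (simp add: cont_ring_simps vanishing_ideal_def)
      fix g assume "g \<in> vanishing_ideal X x"
      with f show "f \<oplus>\<^bsub>cont_ring X\<^esub> g \<in> vanishing_ideal X x"
        using x by (simp add: vanishing_ideal_def cont_ring_simps cont_ring_closed)
    qed
    fix f h assume "f \<in> vanishing_ideal X x" "h \<in> carrier (cont_ring X)"
    then show "h \<otimes>\<^bsub>cont_ring X\<^esub> f \<in> vanishing_ideal X x" "f \<otimes>\<^bsub>cont_ring X\<^esub> h \<in> vanishing_ideal X x"
      using x by (simp_all add: vanishing_ideal_def cont_ring_simps cont_ring_closed)
  qed
qed

lemma one_notin_vanishing_ideal:
  "x \<in> topspace X \<Longrightarrow> \<one>\<^bsub>cont_ring X\<^esub> \<notin> vanishing_ideal X x"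
  by (simp add: vanishing_ideal_def cont_ring_def)

text \<open>This is complete regularity restated for members of the ring. It yields both the injectivity and
  the openness of \<open>x \<mapsto> M\<^sub>x\<close>.\<close>

lemma cont_ring_point_separation:
  assumes "completely_regular_space X" "openin X U" "x \<in> U"
  obtains f where "f \<in> cont_maps X euclideanreal" "f x \<noteq> 0" "\<And>y. y \<in> topspace X - U \<Longrightarrow> f y = 0"
proof -
  obtain g where g: "continuous_map X euclideanreal g" "g x = 0" "g ` (topspace X - U) \<subseteq> {1}"
    using assms unfolding completely_regular_space_alt' by metis
  have "(\<lambda>y\<in>topspace X. 1 - g y) \<in> cont_maps X euclideanreal"
    using g(1) by (intro restrict_in_cont_maps continuous_map_diff) auto
  moreover have "x \<in> topspace X"
    using assms(2,3) openin_subset by blast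
  ultimately show thesis
    using g by (intro that[of "\<lambda>y\<in>topspace X. 1 - g y"]) auto
qed

lemma vanishing_ideal_subset_iff:
  assumes "completely_regular_space X" "Hausdorff_space X" "x \<in> topspace X" "y \<in> topspace X"
  shows "vanishing_ideal X x \<subseteq> vanishing_ideal X y \<longleftrightarrow> x = y"
proof
  assume sub: "vanishing_ideal X x \<subseteq> vanishing_ideal X y"
  show "x = y"
  proof (rule ccontr)
    assume "x \<noteq> y"
    then obtain U where U: "openin X U" "y \<in> U" "x \<notin> U"
      using assms(2-4) unfolding Hausdorff_space_def disjnt_def by (metis disjoint_iff)
    obtain f where "f \<in> cont_maps X euclideanreal" "f y \<noteq> 0" "\<And>z. z \<in> topspace X - U \<Longrightarrow> f z = 0"
      using cont_ring_point_separation[OF assms(1) U(1,2)] by blast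
    then show False
      using sub U(3) assms(3) by (auto simp: vanishing_ideal_def)
  qed
qed simp

lemma openin_nonvanishing:
  assumes "f \<in> cont_maps X euclideanreal"
  shows "openin X {x \<in> topspace X. f x \<noteq> 0}"
proof -
  have "openin X {x \<in> topspace X. f x \<in> - {0}}"
    by (rule openin_continuous_map_preimage[where Y = euclideanreal])
      (use assms in \<open>auto simp: cont_maps_def open_Compl\<close>)
  then show ?thesis
    by simp
qed

text \<open>The witness is the sum of the squares of the members of \<open>F\<close>, built up along the finite set so that
  nonnegativity is available at each step.\<close>

lemma ideal_nonvanishing_finite:
  assumes I: "ideal I (cont_ring X)" and "finite F" "F \<subseteq> I"
  shows "\<exists>u\<in>I. \<forall>x\<in>topspace X. u x \<ge> 0 \<and> ((\<exists>f\<in>F. f x \<noteq> 0) \<longrightarrow> u x > 0)"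
proof -
  interpret cring "cont_ring X" by (rule cring_cont_ring)
  interpret I: ideal I "cont_ring X" by fact
  show ?thesis
    using assms(2,3)
  proof (induction F rule: finite_induct)
    case empty
    show ?case
      using I.zero_closed by (intro bexI[of _ "\<zero>\<^bsub>cont_ring X\<^esub>"]) (simp_all add: cont_ring_def)
  next
    case (insert f F)
    obtain u where u: "u \<in> I" "\<forall>x\<in>topspace X. u x \<ge> 0 \<and> ((\<exists>f\<in>F. f x \<noteq> 0) \<longrightarrow> u x > 0)"
      using insert by blast
    have f: "f \<in> I"
      using insert.prems by simp
    show ?case
    proof (rule bexI[of _ "u \<oplus>\<^bsub>cont_ring X\<^esub> f \<otimes>\<^bsub>cont_ring X\<^esub> f"])
      show "u \<oplus>\<^bsub>cont_ring X\<^esub> f \<otimes>\<^bsub>cont_ring X\<^esub> f \<in> I"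
        using u(1) f by (intro I.a_closed I.I_l_closed I.a_Hcarr)
      have pos: "f x * f x > 0" if "f x \<noteq> 0" for x
        using that by (simp add: zero_less_mult_iff linorder_neq_iff disj_commute)
      show "\<forall>x\<in>topspace X. (u \<oplus>\<^bsub>cont_ring X\<^esub> f \<otimes>\<^bsub>cont_ring X\<^esub> f) x \<ge> 0 \<and>
          ((\<exists>h\<in>insert f F. h x \<noteq> 0) \<longrightarrow> (u \<oplus>\<^bsub>cont_ring X\<^esub> f \<otimes>\<^bsub>cont_ring X\<^esub> f) x > 0)"
        using u(2) pos by (auto simp: cont_ring_def add_pos_nonneg add_nonneg_pos)
    qed
  qed
qed

text \<open>Were there no common zero, the sets on which members of \<open>I\<close> do not vanish would cover \<open>X\<close>; a finite
  subcover gives a strictly positive member of \<open>I\<close>, whose inverse is continuous.\<close>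

lemma proper_ideal_subset_vanishing_ideal:
  assumes "compact_space X" and I: "ideal I (cont_ring X)" "\<one>\<^bsub>cont_ring X\<^esub> \<notin> I"
  shows "\<exists>x\<in>topspace X. I \<subseteq> vanishing_ideal X x"
proof (rule ccontr)
  interpret ideal I "cont_ring X" by (rule I(1))
  have Ic: "f \<in> cont_maps X euclideanreal" if "f \<in> I" for f
    using that a_subset by (auto simp: cont_ring_simps)
  assume "\<not> ?thesis"
  then have nz: "\<exists>f\<in>I. f x \<noteq> 0" if "x \<in> topspace X" for x
    using that Ic by (auto simp: vanishing_ideal_def)
  define D where "D f = {x \<in> topspace X. f x \<noteq> 0}" for f :: "'a \<Rightarrow> real"
  have "openin X (D f)" if "f \<in> I" for f
    using openin_nonvanishing[OF Ic[OF that]] by (simp add: D_def)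
  moreover have "topspace X \<subseteq> \<Union>(D ` I)"
    using nz by (auto simp: D_def)
  ultimately obtain \<F> where "finite \<F>" "\<F> \<subseteq> D ` I" "topspace X \<subseteq> \<Union>\<F>"
    using assms(1) unfolding compact_space_alt by (metis (no_types, lifting) imageE)
  then obtain F where F: "finite F" "F \<subseteq> I" "topspace X \<subseteq> \<Union>(D ` F)"
    by (metis finite_subset_image)
  obtain u where u: "u \<in> I" "\<And>x. x \<in> topspace X \<Longrightarrow> u x > 0"
    using ideal_nonvanishing_finite[OF I(1) F(1,2)] F(3) by (force simp: D_def)
  have "continuous_map X euclideanreal (\<lambda>x. inverse (u x))"
    using Ic[OF u(1)] u(2) by (intro continuous_map_real_inverse) (force simp: cont_maps_def)+
  then have "u \<otimes>\<^bsub>cont_ring X\<^esub> (\<lambda>x\<in>topspace X. inverse (u x)) \<in> I"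
    using u(1) by (intro I_r_closed) (simp_all add: cont_ring_simps restrict_in_cont_maps)
  also have "u \<otimes>\<^bsub>cont_ring X\<^esub> (\<lambda>x\<in>topspace X. inverse (u x)) = \<one>\<^bsub>cont_ring X\<^esub>"
    using less_imp_neq[OF u(2)] by (force simp: cont_ring_def intro!: restrict_ext)
  finally show False
    using I(2) by blast
qed

text \<open>A maximal ideal lies in some proper ideal \<open>M\<^sub>x\<close>, so it equals it. Conversely, a proper ideal above
  \<open>M\<^sub>x\<close> lies in some \<open>M\<^sub>y\<close>, and \<open>M\<^sub>x \<subseteq> M\<^sub>y\<close> forces \<open>x = y\<close>.\<close>

lemma max_spec_cont_ring:
  assumes X: "compact_space X" "completely_regular_space X" "Hausdorff_space X"
  shows "max_spec (cont_ring X) = vanishing_ideal X ` topspace X"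
proof (intro equalityI subsetI)
  fix M assume "M \<in> max_spec (cont_ring X)"
  then interpret maximalideal M "cont_ring X"
    by (simp add: max_spec_def)
  obtain x where x: "x \<in> topspace X" "M \<subseteq> vanishing_ideal X x"
    using proper_ideal_subset_vanishing_ideal[OF X(1) ideal_axioms] I_notcarr one_imp_carrier by blast
  have "vanishing_ideal X x = M \<or> vanishing_ideal X x = carrier (cont_ring X)"
    using x by (intro I_maximal ideal_vanishing_ideal) (auto simp: vanishing_ideal_def cont_ring_simps)
  then show "M \<in> vanishing_ideal X ` topspace X"
    using x(1) one_notin_vanishing_ideal[OF x(1)] one_closed by blast
next
  interpret cring "cont_ring X" by (rule cring_cont_ring)
  fix M assume "M \<in> vanishing_ideal X ` topspace X"
  then obtain x where x: "x \<in> topspace X" and M: "M = vanishing_ideal X x"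
    by blast
  have "maximalideal (vanishing_ideal X x) (cont_ring X)"
  proof (rule maximalidealI)
    show "ideal (vanishing_ideal X x) (cont_ring X)"
      using x by (rule ideal_vanishing_ideal)
    show "carrier (cont_ring X) \<noteq> vanishing_ideal X x"
      using one_notin_vanishing_ideal[OF x] one_closed by blast
    fix J assume J: "ideal J (cont_ring X)" "vanishing_ideal X x \<subseteq> J"
    show "J = vanishing_ideal X x \<or> J = carrier (cont_ring X)"
    proof (cases "\<one>\<^bsub>cont_ring X\<^esub> \<in> J")
      case True
      then show ?thesis
        using ideal.one_imp_carrier[OF J(1)] by simp
    next
      case False
      then obtain y where "y \<in> topspace X" "J \<subseteq> vanishing_ideal X y"
        using proper_ideal_subset_vanishing_ideal[OF X(1) J(1)] by blast
      then show ?thesis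
        using J(2) vanishing_ideal_subset_iff[OF X(2,3) x] by blast
    qed
  qed
  then show "M \<in> max_spec (cont_ring X)"
    by (simp add: M max_spec_def)
qed

lemma openin_max_topology:
  assumes "cring R"
  shows "openin (max_topology R) V \<longleftrightarrow> (\<exists>S \<subseteq> carrier R. V = {M \<in> max_spec R. \<not> S \<subseteq> M})"
proof -
  interpret cring R by fact
  have eq: "(prime_spec R - {P \<in> prime_spec R. S \<subseteq> P}) \<inter> max_spec R = {M \<in> max_spec R. \<not> S \<subseteq> M}" for S
    using maximalideal_prime by (auto simp: max_spec_def prime_spec_def)
  have "openin (max_topology R) V \<longleftrightarrow>
      (\<exists>S \<subseteq> carrier R. V = (prime_spec R - {P \<in> prime_spec R. S \<subseteq> P}) \<inter> max_spec R)"
    unfolding max_topology_def openin_subtopology openin_zariski_topology[OF assms] by blast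
  then show ?thesis
    by (simp only: eq)
qed

text \<open>The preimage of the basic open set of \<open>f\<close> is the set on which \<open>f\<close> does not vanish, which gives
  continuity. For openness, an open \<open>U\<close> is recovered from the set of all functions that vanish off \<open>U\<close>,
  because every point of \<open>U\<close> is detected by one of them.\<close>

lemma homeomorphic_map_vanishing_ideal:
  assumes X: "compact_space X" "Hausdorff_space X"
  shows "homeomorphic_map X (max_topology (cont_ring X)) (vanishing_ideal X)"
proof -
  let ?R = "cont_ring X"
  have reg: "completely_regular_space X"
    using X by (simp add: compact_Hausdorff_or_regular_imp_normal_space normal_imp_completely_regular_space)
  note spec = max_spec_cont_ring[OF X(1) reg X(2)]
  note top = topspace_max_topology[OF cring_cont_ring, of X]
  have mem: "f \<in> vanishing_ideal X x \<longleftrightarrow> f x = 0" if "f \<in> carrier ?R" for f x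
    using that by (simp add: vanishing_ideal_def cont_ring_simps)
  show ?thesis
  proof (rule bijective_open_imp_homeomorphic_map)
    show "continuous_map X (max_topology ?R) (vanishing_ideal X)"
      unfolding continuous_map_def
    proof (intro conjI allI impI)
      show "vanishing_ideal X \<in> topspace X \<rightarrow> topspace (max_topology ?R)"
        by (simp add: top spec)
      fix V assume "openin (max_topology ?R) V"
      then obtain S where S: "S \<subseteq> carrier ?R" "V = {M \<in> max_spec ?R. \<not> S \<subseteq> M}"
        by (auto simp: openin_max_topology[OF cring_cont_ring])
      have "{x \<in> topspace X. vanishing_ideal X x \<in> V} = (\<Union>f\<in>S. {x \<in> topspace X. f x \<noteq> 0})"
        using S(1) mem by (auto simp: S(2) spec subset_iff)
      also have "openin X \<dots>"
        using S(1) by (auto simp: cont_ring_simps intro!: openin_nonvanishing)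
      finally show "openin X {x \<in> topspace X. vanishing_ideal X x \<in> V}" .
    qed
    show "open_map X (max_topology ?R) (vanishing_ideal X)"
      unfolding open_map_def
    proof (intro allI impI)
      fix U assume U: "openin X U"
      let ?S = "{f \<in> carrier ?R. \<forall>y\<in>topspace X - U. f y = 0}"
      have "\<not> ?S \<subseteq> vanishing_ideal X x \<longleftrightarrow> x \<in> U" if x: "x \<in> topspace X" for x
      proof
        assume "x \<in> U"
        then obtain f where "f \<in> cont_maps X euclideanreal" "f x \<noteq> 0" "\<And>y. y \<in> topspace X - U \<Longrightarrow> f y = 0"
          using cont_ring_point_separation[OF reg U] by blast
        then have "f \<in> ?S" "f \<notin> vanishing_ideal X x"
          by (auto simp: cont_ring_simps vanishing_ideal_def)
        then show "\<not> ?S \<subseteq> vanishing_ideal X x"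
          by blast
      qed (use x mem in auto)
      then have "vanishing_ideal X ` U = {M \<in> max_spec ?R. \<not> ?S \<subseteq> M}"
        using openin_subset[OF U] unfolding spec by blast
      moreover have "?S \<subseteq> carrier ?R"
        by blast
      ultimately show "openin (max_topology ?R) (vanishing_ideal X ` U)"
        unfolding openin_max_topology[OF cring_cont_ring] by blast
    qed
    show "vanishing_ideal X ` topspace X = topspace (max_topology ?R)"
      by (simp add: top spec)
    show "inj_on (vanishing_ideal X) (topspace X)"
      using vanishing_ideal_subset_iff[OF reg X(2)] by (auto simp: inj_on_def)
  qed
qed


section \<open>Spectral maps of a ring of continuous functions\<close>

definition composition_operator :: "'a topology \<Rightarrow> ('a \<Rightarrow> 'a) \<Rightarrow> ('a \<Rightarrow> real) \<Rightarrow> 'a \<Rightarrow> real" where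
  "composition_operator X g = (\<lambda>f\<in>cont_maps X euclideanreal. \<lambda>x\<in>topspace X. f (g x))"

lemma composition_operator_closed:
  assumes "continuous_map X X g" "f \<in> cont_maps X euclideanreal"
  shows "composition_operator X g f \<in> cont_maps X euclideanreal"
proof -
  have "continuous_map X euclideanreal (f \<circ> g)"
    using assms continuous_map_compose[of X X g euclideanreal f] by (simp add: cont_maps_def)
  from restrict_in_cont_maps[OF this] show ?thesis
    using assms(2) by (simp add: composition_operator_def o_def)
qed

lemma composition_operator_ring_hom:
  assumes "continuous_map X X g"
  shows "composition_operator X g \<in> ring_hom (cont_ring X) (cont_ring X)"
proof -
  have "g x \<in> topspace X" if "x \<in> topspace X" for x
    using assms that by (auto simp: continuous_map_def)
  then show ?thesis
    using composition_operator_closed[OF assms]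
    by (intro ring_hom_memI; simp add: cont_ring_simps cont_ring_closed cont_ring_const_closed
        composition_operator_def cong: restrict_cong)
qed

lemma composition_operator_real_endo:
  assumes "continuous_map X X g"
  shows "composition_operator X g \<in> algebra_endos real_ring (cont_real_algebra X)"
proof -
  have "g x \<in> topspace X" if "x \<in> topspace X" for x
    using assms that by (auto simp: continuous_map_def)
  then have "composition_operator X g (\<lambda>x\<in>topspace X. c * f x) =
      (\<lambda>x\<in>topspace X. c * composition_operator X g f x)" if "f \<in> cont_maps X euclideanreal" for c f
    using that by (simp add: composition_operator_def cont_ring_closed(3)[OF that that] cong: restrict_cong)
  moreover have "composition_operator X g \<in> extensional (cont_maps X euclideanreal)"
    by (simp add: composition_operator_def)
  ultimately show ?thesis
    using composition_operator_ring_hom[OF assms]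
    by (simp add: algebra_endos_def cont_real_algebra_def ring.defs module.defs ring_hom_def cont_ring_simps)
qed

text \<open>Multiplication by an integer is iterated addition, which every additive map respects.\<close>

lemma ring_hom_int_algebra_endo:
  assumes "cring R" "f \<in> ring_hom R R" "f \<in> extensional (carrier R)"
  shows "f \<in> algebra_endos \<Z> (int_algebra R)"
proof -
  interpret cring R by fact
  have "f \<in> hom (add_monoid R) (add_monoid R)"
    using assms(2) by (intro homI) (simp_all add: ring_hom_add ring_hom_closed)
  then have "f ([n] \<cdot>\<^bsub>R\<^esub> a) = [n] \<cdot>\<^bsub>R\<^esub> f a" if "a \<in> carrier R" for n :: int and a
    using hom_int_pow[of f "add_monoid R" "add_monoid R" a n] that add.group_axioms
    unfolding add_pow_def by simp
  then have "\<forall>n\<in>carrier \<Z>. \<forall>a\<in>carrier R. f ([n] \<cdot>\<^bsub>R\<^esub> a) = [n] \<cdot>\<^bsub>R\<^esub> f a"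
    by blast
  then show ?thesis
    using assms(2,3) by (simp add: algebra_endos_def int_algebra_def ring_hom_def ring.defs module.defs)
qed

text \<open>Ideals do not see the scalar multiplication, so the algebra structures over \<open>\<real>\<close> and \<open>\<int>\<close> share one
  maximal ideal space with the underlying ring.\<close>

lemma max_spec_extend:
  assumes "cring R"
  shows "max_spec (ring.extend R e) = max_spec R"
proof -
  have "maximalideal I (ring.extend R e) \<longleftrightarrow> maximalideal I R" for I
    unfolding maximalideal_def maximalideal_axioms_def ideal_extend[OF assms] by (simp add: ring.defs)
  then show ?thesis
    by (simp only: max_spec_def)
qed

lemma max_topology_extend:
  assumes "cring R"
  shows "max_topology (ring.extend R e) = max_topology R"
proof -
  have "carrier (ring.extend R e) = carrier R"
    by (simp add: ring.defs)
  then have "openin (max_topology (ring.extend R e)) V \<longleftrightarrow> openin (max_topology R) V" for V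
    by (simp only: openin_max_topology[OF assms] openin_max_topology[OF cring_extend[OF assms]]
        max_spec_extend[OF assms])
  then show ?thesis
    unfolding topology_eq by blast
qed

lemma spectral_map_composition_operator:
  assumes X: "compact_space X" "Hausdorff_space X" and g: "continuous_map X X g"
    and x: "x \<in> topspace X"
  shows "spectral_map (ring.extend (cont_ring X) e) (composition_operator X g) (vanishing_ideal X x) =
    vanishing_ideal X (g x)"
proof -
  let ?A = "ring.extend (cont_ring X) e"
  have "vanishing_ideal X ` topspace X = max_spec ?A"
    using homeomorphic_imp_surjective_map[OF homeomorphic_map_vanishing_ideal[OF X]]
    by (simp only: max_spec_extend[OF cring_cont_ring] topspace_max_topology[OF cring_cont_ring])
  then have top: "vanishing_ideal X y \<in> max_spec ?A" if "y \<in> topspace X" for y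
    using that by blast
  have gx: "g x \<in> topspace X"
    using g x by (auto simp: continuous_map_def)
  have "composition_operator X g -` vanishing_ideal X x \<inter> carrier ?A = vanishing_ideal X (g x)"
  proof -
    have "composition_operator X g f x = f (g x)" if "f \<in> cont_maps X euclideanreal" for f
      using that x by (simp add: composition_operator_def)
    moreover have "carrier ?A = cont_maps X euclideanreal"
      by (simp add: ring.defs cont_ring_simps)
    ultimately show ?thesis
      using composition_operator_closed[OF g] by (auto simp: vanishing_ideal_def)
  qed
  then show ?thesis
    using top[OF x] pm_retraction_maximal[OF pm_ring_extend[OF pm_ring_cont_ring] top[OF gx]]
    by (simp add: spectral_map_def)
qed

text \<open>Every continuous self-map \<open>h\<close> of the maximal ideal space is the spectral map of the composition
  operator of its transport to \<open>X\<close>. The set of spectral maps therefore contains the whole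
  compact-open space, and the subspace topology on it is the compact-open topology itself.\<close>

lemma spectral_maps_topology_cont_ring:
  assumes X: "compact_space X" "Hausdorff_space X"
    and endo: "\<And>g. continuous_map X X g \<Longrightarrow>
      composition_operator X g \<in> algebra_endos k (ring.extend (cont_ring X) e)"
  shows "spectral_maps_topology k (ring.extend (cont_ring X) e) =
    compact_open_topology (max_topology (cont_ring X)) (max_topology (cont_ring X))"
proof -
  let ?A = "ring.extend (cont_ring X) e" and ?Y = "max_topology (cont_ring X)"
  obtain q where "homeomorphic_maps X ?Y (vanishing_ideal X) q"
    using homeomorphic_map_vanishing_ideal[OF X] homeomorphic_map_maps by blast
  then have p: "continuous_map X ?Y (vanishing_ideal X)" and q: "continuous_map ?Y X q"
    and pq: "\<And>M. M \<in> topspace ?Y \<Longrightarrow> vanishing_ideal X (q M) = M"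
    by (auto simp: homeomorphic_maps_def)
  have Y: "topspace ?Y = max_spec ?A"
    by (simp only: topspace_max_topology[OF cring_cont_ring] max_spec_extend[OF cring_cont_ring])
  have "h \<in> spectral_map ?A ` algebra_endos k ?A" if h: "h \<in> cont_maps ?Y ?Y" for h
  proof -
    let ?g = "q \<circ> h \<circ> vanishing_ideal X"
    have hc: "continuous_map ?Y ?Y h"
      using h by (simp add: cont_maps_def)
    then have g: "continuous_map X X ?g"
      using p q by (intro continuous_map_compose)
    have eq: "spectral_map ?A (composition_operator X ?g) = h"
    proof (rule extensionalityI[of _ "topspace ?Y"])
      fix M assume M: "M \<in> topspace ?Y"
      have "q M \<in> topspace X" "h M \<in> topspace ?Y"
        using q hc M by (auto simp: continuous_map_def)
      then show "spectral_map ?A (composition_operator X ?g) M = h M"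
        using spectral_map_composition_operator[OF X g, of "q M" e] M by (simp add: pq)
    qed (use h in \<open>simp_all add: Y spectral_map_def cont_maps_def\<close>)
    have "spectral_map ?A (composition_operator X ?g) \<in> spectral_map ?A ` algebra_endos k ?A"
      using endo[OF g] by (rule imageI)
    then show ?thesis
      unfolding eq .
  qed
  then show ?thesis
    unfolding spectral_maps_topology_def max_topology_extend[OF cring_cont_ring]
    by (intro subtopology_superset) (auto simp: topspace_compact_open_topology)
qed

lemma spectral_fundamental_group_cont_ring:
  assumes X: "compact_space X" "Hausdorff_space X"
    and endo: "\<And>g. continuous_map X X g \<Longrightarrow>
      composition_operator X g \<in> algebra_endos k (ring.extend (cont_ring X) e)"
  shows "spectral_fundamental_group k (ring.extend (cont_ring X) e) =
    fundamental_group (compact_open_topology (max_topology (cont_ring X)) (max_topology (cont_ring X)))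
      (\<lambda>M\<in>topspace (max_topology (cont_ring X)). M)"
proof -
  have top: "spectral_maps_topology k (ring.extend (cont_ring X) e) =
      compact_open_topology (max_topology (cont_ring X)) (max_topology (cont_ring X))"
    by (rule spectral_maps_topology_cont_ring[OF X endo])
  show ?thesis
    unfolding spectral_fundamental_group_def top spectral_map_id[OF pm_ring_extend[OF pm_ring_cont_ring]]
      max_spec_extend[OF cring_cont_ring] topspace_max_topology[OF cring_cont_ring] ..
qed

theorem corollary4p7:
  fixes X :: "'a topology"
  assumes "compact_space X" and "Hausdorff_space X"
  shows "spectral_fundamental_group real_ring (cont_real_algebra X) \<cong>
           spectral_fundamental_group \<Z> (int_algebra (cont_ring X)) \<and>
         spectral_fundamental_group \<Z> (int_algebra (cont_ring X)) \<cong>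
           fundamental_group (compact_open_topology X X) (\<lambda>x\<in>topspace X. x)"
proof -
  let ?Y = "max_topology (cont_ring X)"
  let ?G = "fundamental_group (compact_open_topology ?Y ?Y) (\<lambda>M\<in>topspace ?Y. M)"
  have real: "spectral_fundamental_group real_ring (cont_real_algebra X) = ?G"
    unfolding cont_real_algebra_def
    by (intro spectral_fundamental_group_cont_ring assms
        composition_operator_real_endo[unfolded cont_real_algebra_def])
  have "composition_operator X g \<in> algebra_endos \<Z> (int_algebra (cont_ring X))"
    if "continuous_map X X g" for g
    using that by (intro ring_hom_int_algebra_endo cring_cont_ring composition_operator_ring_hom)
      (auto simp: composition_operator_def cont_ring_simps)
  then have int: "spectral_fundamental_group \<Z> (int_algebra (cont_ring X)) = ?G"
    unfolding int_algebra_def by (intro spectral_fundamental_group_cont_ring assms)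
  obtain q where q: "homeomorphic_maps X ?Y (vanishing_ideal X) q"
    using homeomorphic_map_vanishing_ideal[OF assms] homeomorphic_map_maps by blast
  have id: "(\<lambda>M\<in>topspace ?Y. M) \<in> topspace (compact_open_topology ?Y ?Y)"
    by (simp add: topspace_compact_open_topology restrict_in_cont_maps continuous_map_id[unfolded id_def])
  have base: "(\<lambda>x\<in>topspace X. q ((\<lambda>M\<in>topspace ?Y. M) (vanishing_ideal X x))) = (\<lambda>x\<in>topspace X. x)"
    using q by (auto simp: homeomorphic_maps_def continuous_map_def intro!: restrict_ext)
  have "homeomorphic_maps ?Y X q (vanishing_ideal X)"
    using q homeomorphic_maps_sym by blast
  then have "homeomorphic_maps (compact_open_topology ?Y ?Y) (compact_open_topology X X)
      (\<lambda>h. \<lambda>x\<in>topspace X. q (h (vanishing_ideal X x)))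
      (\<lambda>g. \<lambda>M\<in>topspace ?Y. vanishing_ideal X (g (q M)))"
    by (rule homeomorphic_maps_compact_open)
  from fundamental_group_homeomorphic[OF this id]
  have "?G \<cong> fundamental_group (compact_open_topology X X) (\<lambda>x\<in>topspace X. x)"
    unfolding base .
  then show ?thesis
    unfolding real int using iso_refl by blast
qed

end
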